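(* Fix $p\in(0,1/2)$ and an integer $L\ge0$. There exists a constant $C_L>0$ depending only on $L$ such that for all $\gamma\in(0,1)$ and all sufficiently large $n$ the following holds. Suppose $k\le(1-\gamma)n$ and let $\mathcal{C}=\mathrm{span}(b_1,\dots,b_k)\subseteq\mathbb{F}_2^n$ where $b_1,\dots,b_k$ are independent uniform vectors in $\mathbb{F}_2^n$. Then with probability at least $1-\exp(-C_L\gamma n)$, for all $1\le\ell\le L$, $$Q_{\mathcal{C}}^{(\ge\ell)}\le\left(2^{-n(1-H(p))}\cdot2^k\right)^\ell\cdot2^{\gamma\ell^2n}.$$
   Context: $\Delta$ is Hamming distance, $L_{\mathcal{C}}(x)=|\{c\in\mathcal{C}:\Delta(x,c)\le pn\}|$, $H(p)=-p\log_2p-(1-p)\log_2(1-p)$. $P_{\mathcal{C}}^{(\ell)}=2^{-n}|\{x\in\mathbb{F}_2^n:L_{\mathcal{C}}(x)=\ell\}|$ and $Q_{\mathcal{C}}^{(\ge\ell)}=\sum_{i\ge\ell}i\cdot P_{\mathcal{C}}^{(i)}$. *)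

theory Defs
  imports Complex_Main
begin

text \<open>Vectors of F_2^n are boolean lists of length n (True = 1).\<close>

definition vecs :: "nat \<Rightarrow> bool list set" where
  "vecs n = {x. length x = n}"

definition vadd :: "bool list \<Rightarrow> bool list \<Rightarrow> bool list" where
  "vadd x y = map2 (\<noteq>) x y"

definition hdist :: "bool list \<Rightarrow> bool list \<Rightarrow> nat" where
  "hdist x y = card {i. i < length x \<and> x ! i \<noteq> y ! i}"

fun lin_span :: "nat \<Rightarrow> bool list list \<Rightarrow> bool list set" where
  "lin_span n [] = {replicate n False}"
| "lin_span n (b # bs) = lin_span n bs \<union> (vadd b) ` lin_span n bs"

definition H :: "real \<Rightarrow> real" where
  "H p = - p * log 2 p - (1 - p) * log 2 (1 - p)"

definition list_size :: "nat \<Rightarrow> real \<Rightarrow> bool list set \<Rightarrow> bool list \<Rightarrow> nat" where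
  "list_size n p C x = card {c \<in> C. real (hdist x c) \<le> p * real n}"

definition P_frac :: "nat \<Rightarrow> real \<Rightarrow> bool list set \<Rightarrow> nat \<Rightarrow> real" where
  "P_frac n p C l = real (card {x \<in> vecs n. list_size n p C x = l}) / 2 ^ n"

text \<open>Q^{(>= l)} = sum_{i >= l} i * P^{(i)}; terms with i > 2^n vanish for codes in F_2^n
  (since L_C(x) <= |C| <= 2^n), so the sum is truncated at 2^n.\<close>
definition Q_ge :: "nat \<Rightarrow> real \<Rightarrow> bool list set \<Rightarrow> nat \<Rightarrow> real" where
  "Q_ge n p C l = (\<Sum>i\<in>{l..2 ^ n}. real i * P_frac n p C i)"

text \<open>Sample space of k independent uniform vectors of F_2^n (uniform on tuples).\<close>
definition tuples :: "nat \<Rightarrow> nat \<Rightarrow> bool list list set" where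
  "tuples n k = {bs. length bs = k \<and> (\<forall>b\<in>set bs. b \<in> vecs n)}"

end

theory Submission
  imports Defs "HOL-Real_Asymp.Real_Asymp"
begin

text \<open>
  Add the generators one at a time. Adjoining \<open>b\<close> to the code replaces \<open>L(x)\<close> by at most
  \<open>L(x) + L(x + b)\<close>, so \<open>Q\<^sup>(\<^sup>\<ge>\<^sup>l\<^sup>)\<close> at most doubles, up to cross terms in which \<open>L(x) \<ge> i\<close> and
  \<open>L(x + b) \<ge> l - i\<close> with \<open>0 < i < l\<close>. Since \<open>x\<close> and \<open>x + b\<close> are independent and uniform, the
  expected cross terms are products \<open>Q\<^sup>(\<^sup>\<ge>\<^sup>i\<^sup>) Q\<^sup>(\<^sup>\<ge>\<^sup>l\<^sup>-\<^sup>i\<^sup>)\<close>, and \<open>i\<^sup>2 + (l - i)\<^sup>2 \<le> l\<^sup>2 - 2\<close> makes these smaller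
  than the desired bound by a factor \<open>2\<^sup>-\<^sup>2\<^sup>\<gamma>\<^sup>n\<close>. By Markov's inequality and a union bound over at most \<open>n\<close>
  steps, the bound survives all steps except with probability at most \<open>n L\<^sup>2 2\<^sup>-\<^sup>2\<^sup>\<gamma>\<^sup>n \<le> exp (- \<gamma> n)\<close>.
\<close>

section \<open>Boolean vectors\<close>

lemma vecs_0: "vecs 0 = {[]}"
  by (auto simp: vecs_def)

lemma vecs_Suc: "vecs (Suc n) = Cons True ` vecs n \<union> Cons False ` vecs n"
proof -
  have "x \<in> Cons True ` vecs n \<union> Cons False ` vecs n" if "length x = Suc n" for x
    using that by (cases x) (auto simp: vecs_def image_iff)
  then show ?thesis
    by (auto simp: vecs_def)
qed

lemma vecs_eq_lists: "vecs n = {xs. set xs \<subseteq> UNIV \<and> length xs = n}"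
  by (simp add: vecs_def)

lemma finite_vecs [simp]: "finite (vecs n)"
  unfolding vecs_eq_lists by (rule finite_lists_length_eq) simp

lemma card_vecs [simp]: "card (vecs n) = 2 ^ n"
  unfolding vecs_eq_lists by (subst card_lists_length_eq) auto

lemma vadd_in_vecs: "x \<in> vecs n \<Longrightarrow> y \<in> vecs n \<Longrightarrow> vadd x y \<in> vecs n"
  by (simp add: vecs_def vadd_def)

lemma vadd_cancel: "x \<in> vecs n \<Longrightarrow> y \<in> vecs n \<Longrightarrow> vadd (vadd x y) y = x"
  by (rule nth_equalityI) (auto simp: vecs_def vadd_def)

lemma vadd_commute: "x \<in> vecs n \<Longrightarrow> y \<in> vecs n \<Longrightarrow> vadd x y = vadd y x"
  by (rule nth_equalityI) (auto simp: vecs_def vadd_def)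

lemma hdist_vadd:
  assumes "x \<in> vecs n" "b \<in> vecs n" "c \<in> vecs n"
  shows "hdist x (vadd b c) = hdist (vadd x b) c"
  using assms by (auto simp: hdist_def vecs_def vadd_def intro!: arg_cong[where f = card])

lemma sum_vecs_vadd:
  assumes "b \<in> vecs n"
  shows "(\<Sum>x\<in>vecs n. f (vadd x b)) = (\<Sum>x\<in>vecs n. f x)"
  by (rule sum.reindex_bij_witness[where i = "\<lambda>x. vadd x b" and j = "\<lambda>x. vadd x b"])
    (use assms in \<open>auto simp: vadd_cancel vadd_in_vecs\<close>)

lemma sum_vecs_vadd':
  assumes "x \<in> vecs n"
  shows "(\<Sum>b\<in>vecs n. f (vadd x b)) = (\<Sum>b\<in>vecs n. f b)"
proof -
  have "(\<Sum>b\<in>vecs n. f (vadd x b)) = (\<Sum>b\<in>vecs n. f (vadd b x))"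
    using assms by (intro sum.cong refl arg_cong[where f = f]) (rule vadd_commute)
  then show ?thesis
    using sum_vecs_vadd[OF assms, of f] by simp
qed

lemma lin_span_subset_vecs: "set bs \<subseteq> vecs n \<Longrightarrow> lin_span n bs \<subseteq> vecs n"
proof (induction bs)
  case Nil
  then show ?case by (simp add: vecs_def)
next
  case (Cons b bs)
  then show ?case by (auto intro: vadd_in_vecs)
qed

section \<open>Tuples of generators\<close>

lemma tuples_0: "tuples n 0 = {[]}"
  by (auto simp: tuples_def)

lemma tuples_Suc: "tuples n (Suc k) = (\<lambda>(b, bs). b # bs) ` (vecs n \<times> tuples n k)"
proof -
  have "bs \<in> (\<lambda>(b, bs). b # bs) ` (vecs n \<times> tuples n k)" if "bs \<in> tuples n (Suc k)" for bs
    using that by (cases bs) (auto simp: tuples_def image_iff)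
  then show ?thesis
    by (auto simp: tuples_def)
qed

lemma tuples_eq_lists: "tuples n k = {bs. set bs \<subseteq> vecs n \<and> length bs = k}"
  by (auto simp: tuples_def)

lemma finite_tuples [simp]: "finite (tuples n k)"
  by (simp add: tuples_eq_lists finite_lists_length_eq)

lemma card_tuples: "card (tuples n k) = (2 ^ n) ^ k"
  by (simp add: tuples_eq_lists card_lists_length_eq)

section \<open>The volume of a Hamming ball\<close>

text \<open>Total mass of the product Bernoulli measure; splitting off the first coordinate
  contributes p + (1 - p) = 1.\<close>

lemma sum_weight_vecs:
  fixes p :: real
  shows "(\<Sum>x\<in>vecs n. p ^ length (filter id x) * (1 - p) ^ (n - length (filter id x))) = 1"
proof (induction n)
  case 0
  then show ?case by (simp add: vecs_0)
next
  case (Suc n)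
  let ?w = "\<lambda>n x. p ^ length (filter id x) * (1 - p) ^ (n - length (filter id x))"
  have "(\<Sum>x\<in>vecs (Suc n). ?w (Suc n) x)
      = (\<Sum>x\<in>Cons True ` vecs n. ?w (Suc n) x) + (\<Sum>x\<in>Cons False ` vecs n. ?w (Suc n) x)"
    unfolding vecs_Suc by (rule sum.union_disjoint) auto
  also have "(\<Sum>x\<in>Cons True ` vecs n. ?w (Suc n) x) = (\<Sum>x\<in>vecs n. p * ?w n x)"
    by (subst sum.reindex) (auto simp: mult_ac)
  also have "(\<Sum>x\<in>Cons False ` vecs n. ?w (Suc n) x) = (\<Sum>x\<in>vecs n. (1 - p) * ?w n x)"
  proof (subst sum.reindex)
    show "sum (?w (Suc n) \<circ> (#) False) (vecs n) = (\<Sum>x\<in>vecs n. (1 - p) * ?w n x)"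
    proof (rule sum.cong)
      fix x assume "x \<in> vecs n"
      then have "length (filter id x) \<le> n"
        by (auto simp: vecs_def)
      then show "(?w (Suc n) \<circ> (#) False) x = (1 - p) * ?w n x"
        by (simp add: Suc_diff_le)
    qed simp
  qed simp
  finally show ?case
    using Suc by (simp add: sum_distrib_left[symmetric])
qed

text \<open>The right-hand side is the Bernoulli mass of a point of weight p n, with real exponents
  because p n need not be an integer.\<close>

lemma powr_H:
  assumes "0 < p" "p < 1"
  shows "2 powr (- real n * H p) = p powr (p * n) * (1 - p) powr ((1 - p) * n)"
proof -
  have "2 powr (- real n * H p) = 2 powr (log 2 p * (p * n)) * 2 powr (log 2 (1 - p) * ((1 - p) * n))"
    by (simp add: H_def powr_add[symmetric] algebra_simps)
  then show ?thesis
    using assms by (simp add: powr_powr[symmetric])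
qed

text \<open>Under the Bernoulli measure every point of the ball has mass at least 2^(-n H(p)),
  because p < 1/2 makes the mass decrease with the weight. The total mass 1 then bounds the number
  of points.\<close>

lemma card_ball_le:
  assumes p: "0 < p" "p < 1/2"
  shows "real (card {x \<in> vecs n. real (hdist x (replicate n False)) \<le> p * real n})
    \<le> 2 powr (real n * H p)"
proof -
  let ?B = "{x \<in> vecs n. real (hdist x (replicate n False)) \<le> p * real n}"
  let ?w = "\<lambda>x. length (filter id x)"
  have weight: "2 powr (- real n * H p) \<le> p ^ ?w x * (1 - p) ^ (n - ?w x)" if "x \<in> ?B" for x
  proof -
    have len: "length x = n"
      using that by (simp add: vecs_def)
    have "hdist x (replicate n False) = ?w x"
      using len by (auto simp: hdist_def length_filter_conv_card intro!: arg_cong[where f = card])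
    then have w: "real (?w x) \<le> p * n"
      using that by simp
    have "?w x \<le> n"
      using len by auto
    \<comment> \<open>The slack below the radius: passing from weight p n to the actual weight
      replaces d factors p by d factors 1 - p, which cannot lower the mass.\<close>
    define d where "d = p * n - ?w x"
    have "2 powr (- real n * H p) = p powr (?w x + d) * (1 - p) powr (real (n - ?w x) - d)"
      using p \<open>?w x \<le> n\<close> powr_H[of p n] by (simp add: d_def of_nat_diff algebra_simps)
    also have "\<dots> = p ^ ?w x * (1 - p) ^ (n - ?w x) * (p powr d * (1 - p) powr (- d))"
      using p unfolding powr_add diff_conv_add_uminus by (simp add: powr_realpow)
    also have "p powr d \<le> (1 - p) powr d"
      using p w by (intro powr_mono2) (auto simp: d_def)
    then have "p powr d * (1 - p) powr (- d) \<le> 1"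
      using p by (simp add: powr_minus divide_simps)
    then have "p ^ ?w x * (1 - p) ^ (n - ?w x) * (p powr d * (1 - p) powr (- d))
        \<le> p ^ ?w x * (1 - p) ^ (n - ?w x)"
      using p by (intro mult_left_le) auto
    finally show ?thesis .
  qed
  have "card ?B * 2 powr (- real n * H p) \<le> (\<Sum>x\<in>?B. p ^ ?w x * (1 - p) ^ (n - ?w x))"
    using sum_mono[OF weight, of ?B "\<lambda>x. x"] by simp
  also have "\<dots> \<le> (\<Sum>x\<in>vecs n. p ^ ?w x * (1 - p) ^ (n - ?w x))"
    using p by (intro sum_mono2) auto
  also have "\<dots> = 1"
    by (rule sum_weight_vecs)
  finally show ?thesis
    by (simp add: powr_minus divide_simps)
qed

section \<open>Adjoining one generator\<close>

text \<open>The contribution to \<open>Q_ge\<close> of a point with list size m; it turns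
  \<open>Q_ge\<close> into an average over points, where translation by b can be used.\<close>

definition truncated :: "nat \<Rightarrow> nat \<Rightarrow> real" where
  "truncated l m = (if l \<le> m then real m else 0)"

lemma truncated_nonneg [simp]: "0 \<le> truncated l m"
  by (simp add: truncated_def)

lemma truncated_mono: "m \<le> m' \<Longrightarrow> truncated l m \<le> truncated l m'"
  by (auto simp: truncated_def)

text \<open>If 0 < a < l, 0 < b and a + b >= l, the split i = a contributes a b, and a + b <= 2 a b
  for positive integers; this is the factor 2. If 0 < b < l <= a, only b is missing on the right,
  and the split i = l - b pays for it.\<close>

lemma truncated_add_le:
  "truncated l (a + b) \<le> truncated l a + truncated l b
    + 2 * (\<Sum>i\<in>{1..<l}. truncated i a * truncated (l - i) b)"
proof -
  let ?S = "\<Sum>i\<in>{1..<l}. truncated i a * truncated (l - i) b"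
  have single: "truncated i a * truncated (l - i) b \<le> ?S" if "i \<in> {1..<l}" for i
    by (rule member_le_sum[OF that]) auto
  have "0 \<le> ?S"
    by (intro sum_nonneg) auto
  \<comment> \<open>The situation 0 < a < l <= b falls under the fourth case, so the asymmetric list
    is exhaustive.\<close>
  consider "a + b < l" | "a = 0 \<or> b = 0" | "l \<le> a" "l \<le> b"
    | "1 \<le> a" "a < l" "1 \<le> b" "l \<le> a + b" | "l \<le> a" "1 \<le> b" "b < l"
    by linarith
  then show ?thesis
  proof cases
    case 4
    have "real a * real b \<le> ?S"
      using single[of a] 4 by (simp add: truncated_def split: if_splits)
    moreover have "real a + real b \<le> 2 * (real a * real b)"
    proof -
      have "real a * 1 \<le> real a * real b" "1 * real b \<le> real a * real b"
        using 4 by (intro mult_mono; simp)+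
      then show ?thesis by simp
    qed
    ultimately have "truncated l (a + b) \<le> 2 * ?S"
      using 4 by (simp add: truncated_def)
    then show ?thesis
      using truncated_nonneg[of l a] truncated_nonneg[of l b] by linarith
  next
    case 5
    have "real a * real b \<le> ?S"
    proof -
      have "truncated (l - b) a * truncated (l - (l - b)) b = real a * real b"
        using 5 by (simp add: truncated_def)
      moreover have "l - b \<in> {1..<l}"
        using 5 by auto
      ultimately show ?thesis
        using single[of "l - b"] by simp
    qed
    moreover have "1 * real b \<le> real a * real b"
      using 5 by (intro mult_mono) auto
    ultimately have "real b \<le> 2 * ?S" using \<open>0 \<le> ?S\<close> by linarith
    then show ?thesis
      using 5 by (simp add: truncated_def)
  qed (use \<open>0 \<le> ?S\<close> in \<open>auto simp: truncated_def\<close>)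
qed

text \<open>Points are grouped by list size; the cut-off at 2^n loses nothing since a list is a
  subset of \<open>vecs n\<close>.\<close>

lemma Q_ge_eq_sum:
  assumes "C \<subseteq> vecs n"
  shows "Q_ge n p C l = (\<Sum>x\<in>vecs n. truncated l (list_size n p C x)) / 2 ^ n"
proof -
  let ?s = "list_size n p C"
  have bound: "?s x \<le> 2 ^ n" for x
  proof -
    have "?s x \<le> card (vecs n)"
      unfolding list_size_def using assms by (intro card_mono) auto
    then show ?thesis by simp
  qed
  have "(\<Sum>x\<in>vecs n. truncated l (?s x))
      = (\<Sum>i\<le>2 ^ n. \<Sum>x\<in>{x \<in> vecs n. ?s x = i}. truncated l (?s x))"
    by (rule sum.group[symmetric]) (use bound in auto)
  also have "\<dots> = (\<Sum>i\<le>2 ^ n. real (card {x \<in> vecs n. ?s x = i}) * truncated l i)"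
    by (intro sum.cong) auto
  also have "\<dots> = (\<Sum>i\<in>{l..2 ^ n}. real (card {x \<in> vecs n. ?s x = i}) * real i)"
    by (intro sum.mono_neutral_cong_right) (auto simp: truncated_def)
  finally show ?thesis
    by (simp add: Q_ge_def P_frac_def sum_divide_distrib mult.commute)
qed

lemma Q_ge_nonneg: "0 \<le> Q_ge n p C l"
  by (simp add: Q_ge_def P_frac_def sum_nonneg)

text \<open>The word b + c is as far from x as c is from x + b. Equality can fail because C and its
  translate may overlap.\<close>

lemma list_size_extend_le:
  assumes C: "C \<subseteq> vecs n" and b: "b \<in> vecs n" and x: "x \<in> vecs n"
  shows "list_size n p (C \<union> vadd b ` C) x \<le> list_size n p C x + list_size n p C (vadd x b)"
proof -
  have fin: "finite C"
    using C finite_vecs by (rule finite_subset)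
  have "{c \<in> C \<union> vadd b ` C. real (hdist x c) \<le> p * n}
      \<subseteq> {c \<in> C. real (hdist x c) \<le> p * n} \<union> vadd b ` {c \<in> C. real (hdist (vadd x b) c) \<le> p * n}"
    using hdist_vadd[OF x b] C by auto
  then have "list_size n p (C \<union> vadd b ` C) x
      \<le> card ({c \<in> C. real (hdist x c) \<le> p * n} \<union> vadd b ` {c \<in> C. real (hdist (vadd x b) c) \<le> p * n})"
    unfolding list_size_def using fin by (intro card_mono) auto
  also have "\<dots> \<le> list_size n p C x + card (vadd b ` {c \<in> C. real (hdist (vadd x b) c) \<le> p * n})"
    unfolding list_size_def by (rule card_Un_le)
  also have "\<dots> \<le> list_size n p C x + list_size n p C (vadd x b)"
    unfolding list_size_def using fin by (intro add_left_mono card_image_le) auto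
  finally show ?thesis .
qed

text \<open>The products from \<open>truncated_add_le\<close>, averaged over x. In the resulting
  recursion this is the only term that depends on b.\<close>

definition cross :: "nat \<Rightarrow> real \<Rightarrow> bool list set \<Rightarrow> nat \<Rightarrow> bool list \<Rightarrow> real" where
  "cross n p C l b = (\<Sum>x\<in>vecs n. \<Sum>i\<in>{1..<l}.
      truncated i (list_size n p C x) * truncated (l - i) (list_size n p C (vadd x b))) / 2 ^ n"

lemma cross_nonneg: "0 \<le> cross n p C l b"
  by (simp add: cross_def sum_nonneg)

text \<open>Translation by b permutes the space, so the lists at x and at x + b each contribute one
  copy of the old \<open>Q_ge\<close>.\<close>

lemma Q_ge_extend_le:
  assumes C: "C \<subseteq> vecs n" and b: "b \<in> vecs n"
  shows "Q_ge n p (C \<union> vadd b ` C) l \<le> 2 * Q_ge n p C l + 2 * cross n p C l b"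
proof -
  let ?s = "list_size n p C" and ?s' = "list_size n p (C \<union> vadd b ` C)"
  have C': "C \<union> vadd b ` C \<subseteq> vecs n"
    using C b by (auto intro: vadd_in_vecs)
  have "(\<Sum>x\<in>vecs n. truncated l (?s' x))
      \<le> (\<Sum>x\<in>vecs n. truncated l (?s x) + truncated l (?s (vadd x b))
            + 2 * (\<Sum>i\<in>{1..<l}. truncated i (?s x) * truncated (l - i) (?s (vadd x b))))"
    by (intro sum_mono order.trans[OF truncated_mono[OF list_size_extend_le[OF C b]] truncated_add_le])
  also have "\<dots> = 2 * (\<Sum>x\<in>vecs n. truncated l (?s x))
      + 2 * (\<Sum>x\<in>vecs n. \<Sum>i\<in>{1..<l}. truncated i (?s x) * truncated (l - i) (?s (vadd x b)))"
    using sum_vecs_vadd[OF b, of "\<lambda>x. truncated l (?s x)"]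
    by (simp add: sum.distrib sum_distrib_left[symmetric])
  finally show ?thesis
    unfolding Q_ge_eq_sum[OF C] Q_ge_eq_sum[OF C'] cross_def by (simp add: divide_simps)
qed

text \<open>For fixed x the vector x + b runs through the whole space as b does, so the double sum
  factors; this is the independence of x and x + b.\<close>

lemma sum_cross:
  assumes C: "C \<subseteq> vecs n"
  shows "(\<Sum>b\<in>vecs n. cross n p C l b) = 2 ^ n * (\<Sum>i\<in>{1..<l}. Q_ge n p C i * Q_ge n p C (l - i))"
proof -
  let ?t = "\<lambda>i x. truncated i (list_size n p C x)"
  have "(\<Sum>b\<in>vecs n. \<Sum>x\<in>vecs n. \<Sum>i\<in>{1..<l}. ?t i x * ?t (l - i) (vadd x b))
      = (\<Sum>i\<in>{1..<l}. \<Sum>x\<in>vecs n. ?t i x * (\<Sum>b\<in>vecs n. ?t (l - i) (vadd x b)))"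
    unfolding sum_distrib_left
    by (subst sum.swap, subst (2) sum.swap, subst sum.swap, rule refl)
  also have "\<dots> = (\<Sum>i\<in>{1..<l}. \<Sum>x\<in>vecs n. ?t i x * (\<Sum>b\<in>vecs n. ?t (l - i) b))"
    by (intro sum.cong refl arg_cong2[where f = "(*)"] sum_vecs_vadd')
  also have "\<dots> = (\<Sum>i\<in>{1..<l}. (2 ^ n * Q_ge n p C i) * (2 ^ n * Q_ge n p C (l - i)))"
    by (simp add: Q_ge_eq_sum[OF C] sum_distrib_right[symmetric])
  finally show ?thesis
    by (simp add: cross_def sum_divide_distrib[symmetric] sum_distrib_left field_simps)
qed

text \<open>Markov's inequality in counting form.\<close>

lemma card_gt_le_sum:
  fixes f :: "'a \<Rightarrow> real"
  assumes "finite A" "\<And>x. x \<in> A \<Longrightarrow> 0 \<le> f x"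
  shows "real (card {x \<in> A. a < f x}) * a \<le> sum f A"
proof -
  have "real (card {x \<in> A. a < f x}) * a \<le> (\<Sum>x\<in>{x \<in> A. a < f x}. f x)"
    using sum_bounded_below[of "{x \<in> A. a < f x}" a f] by simp
  also have "\<dots> \<le> sum f A"
    using assms by (intro sum_mono2) auto
  finally show ?thesis .
qed

section \<open>Iterating over the generators\<close>

definition target :: "nat \<Rightarrow> real \<Rightarrow> real \<Rightarrow> nat \<Rightarrow> nat \<Rightarrow> real" where
  "target n p \<gamma> k l = (2 powr (- real n * (1 - H p)) * 2 ^ k) ^ l * 2 powr (\<gamma> * real l ^ 2 * real n)"

lemma target_pos: "0 < target n p \<gamma> k l"
  by (simp add: target_def)

lemma target_Suc: "target n p \<gamma> (Suc k) l = 2 ^ l * target n p \<gamma> k l"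
  by (simp add: target_def power_mult_distrib)

text \<open>The powers of the base multiply to exactly \<open>?a ^ l\<close>, so the whole gain
  comes from the quadratic exponent: with j = l - i it is 2 i j >= 2.\<close>

lemma target_mult_le:
  assumes "0 < \<gamma>" "i \<in> {1..<l}"
  shows "target n p \<gamma> k i * target n p \<gamma> k (l - i) \<le> target n p \<gamma> k l * 2 powr (- 2 * \<gamma> * n)"
proof -
  let ?a = "2 powr (- real n * (1 - H p)) * 2 ^ k"
  obtain j where l: "l = i + j" and j: "1 \<le> j" and i: "1 \<le> i"
    using assms(2) by (metis add_diff_inverse_nat atLeastLessThan_iff le_iff_add less_imp_le_nat
        not_less less_add_same_cancel1 Suc_le_eq One_nat_def)
  have "1 * 1 \<le> real i * real j"
    using i j by (intro mult_mono) auto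
  then have "real i ^ 2 + real j ^ 2 \<le> real l ^ 2 - 2"
    by (simp add: l power2_eq_square algebra_simps)
  then have "\<gamma> * n * (real i ^ 2 + real j ^ 2) \<le> \<gamma> * n * (real l ^ 2 - 2)"
    using assms by (intro mult_left_mono) auto
  then have "\<gamma> * real i ^ 2 * n + \<gamma> * real j ^ 2 * n \<le> \<gamma> * real l ^ 2 * n + (- 2 * \<gamma> * n)"
    by (simp add: algebra_simps)
  then have "2 powr (\<gamma> * real i ^ 2 * n + \<gamma> * real j ^ 2 * n)
      \<le> 2 powr (\<gamma> * real l ^ 2 * n + (- 2 * \<gamma> * n))"
    by (rule powr_mono) simp
  then have exps: "2 powr (\<gamma> * real i ^ 2 * n) * 2 powr (\<gamma> * real j ^ 2 * n)
      \<le> 2 powr (\<gamma> * real l ^ 2 * n) * 2 powr (- 2 * \<gamma> * n)"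
    by (simp only: powr_add)
  have "target n p \<gamma> k i * target n p \<gamma> k (l - i)
      = ?a ^ l * (2 powr (\<gamma> * real i ^ 2 * n) * 2 powr (\<gamma> * real j ^ 2 * n))"
    by (simp add: target_def l power_add mult_ac)
  also have "\<dots> \<le> ?a ^ l * (2 powr (\<gamma> * real l ^ 2 * n) * 2 powr (- 2 * \<gamma> * n))"
    by (intro mult_left_mono exps) simp
  also have "\<dots> = target n p \<gamma> k l * 2 powr (- 2 * \<gamma> * n)"
    by (simp only: target_def mult.assoc)
  finally show ?thesis .
qed

text \<open>The induction invariant. All thresholds are carried together because the cross terms for
  l involve the smaller ones.\<close>

definition within_target :: "nat \<Rightarrow> nat \<Rightarrow> real \<Rightarrow> real \<Rightarrow> nat \<Rightarrow> bool list set \<Rightarrow> bool" where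
  "within_target L n p \<gamma> k C \<longleftrightarrow> (\<forall>l\<in>{1..L}. Q_ge n p C l \<le> target n p \<gamma> k l)"

text \<open>Lists for the zero code have at most one element, so only l = 1 contributes; there
  \<open>Q_ge\<close> is the normalised ball volume.\<close>

lemma within_target_zero:
  assumes p: "0 < p" "p < 1/2" and \<gamma>: "0 < \<gamma>"
  shows "within_target L n p \<gamma> 0 {replicate n False}"
  unfolding within_target_def
proof
  fix l assume l: "l \<in> {1..L}"
  let ?z = "replicate n False" let ?C = "{?z}"
  let ?B = "{x \<in> vecs n. real (hdist x ?z) \<le> p * real n}"
  have C: "?C \<subseteq> vecs n" by (simp add: vecs_def)
  have size: "list_size n p ?C x = (if real (hdist x ?z) \<le> p * n then 1 else 0)" for x
  proof -
    have "{c \<in> ?C. real (hdist x c) \<le> p * n} = (if real (hdist x ?z) \<le> p * n then ?C else {})"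
      by auto
    then show ?thesis by (simp add: list_size_def)
  qed
  show "Q_ge n p ?C l \<le> target n p \<gamma> 0 l"
  proof (cases "l = 1")
    case True
    have "Q_ge n p ?C l = (\<Sum>x\<in>vecs n. if real (hdist x ?z) \<le> p * n then 1 else 0) / 2 ^ n"
      unfolding Q_ge_eq_sum[OF C] size True
      by (intro arg_cong2[where f = "(/)"] sum.cong) (auto simp: truncated_def)
    also have "\<dots> = card ?B / 2 ^ n"
      by (simp add: sum.If_cases Int_def)
    also have "\<dots> \<le> 2 powr (real n * H p) / 2 ^ n"
      by (intro divide_right_mono card_ball_le p) simp
    also have "\<dots> = 2 powr (- real n * (1 - H p))"
      by (simp add: powr_realpow[symmetric] powr_diff[symmetric] algebra_simps)
    also have "\<dots> \<le> 2 powr (- real n * (1 - H p)) * 2 powr (\<gamma> * n)"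
      using \<gamma> by (simp add: ge_one_powr_ge_zero)
    finally show ?thesis by (simp add: target_def True)
  next
    case False
    then have "truncated l (list_size n p ?C x) = 0" for x
      using l by (simp add: size truncated_def)
    then have "Q_ge n p ?C l = 0"
      unfolding Q_ge_eq_sum[OF C] by simp
    then show ?thesis
      using target_pos[of n p \<gamma> 0 l] by simp
  qed
qed

text \<open>The target grows by \<open>2 ^ l\<close> per generator. For l >= 2 this absorbs the
  factor 4 from doubling both \<open>Q_ge\<close> and the cross term; for l = 1 there are no cross
  terms and a factor 2 suffices.\<close>

lemma within_target_extend:
  assumes C: "C \<subseteq> vecs n" and b: "b \<in> vecs n" and good: "within_target L n p \<gamma> k C"
    and small: "\<And>l. l \<in> {1..L} \<Longrightarrow> cross n p C l b \<le> target n p \<gamma> k l"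
  shows "within_target L n p \<gamma> (Suc k) (C \<union> vadd b ` C)"
  unfolding within_target_def
proof
  fix l assume l: "l \<in> {1..L}"
  have Q: "Q_ge n p C l \<le> target n p \<gamma> k l"
    using good l by (simp add: within_target_def)
  have step: "Q_ge n p (C \<union> vadd b ` C) l \<le> 2 * Q_ge n p C l + 2 * cross n p C l b"
    by (rule Q_ge_extend_le[OF C b])
  show "Q_ge n p (C \<union> vadd b ` C) l \<le> target n p \<gamma> (Suc k) l"
  proof (cases "l = 1")
    case True
    then have "cross n p C l b = 0" by (simp add: cross_def)
    then show ?thesis using step Q True by (simp add: target_Suc)
  next
    case False
    then have "(2::real) ^ 2 \<le> 2 ^ l"
      using l by (intro power_increasing) auto
    then have "2 ^ 2 * target n p \<gamma> k l \<le> 2 ^ l * target n p \<gamma> k l"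
      using target_pos[of n p \<gamma> k l] by (intro mult_right_mono) auto
    then show ?thesis
      using step Q small[OF l] by (simp add: target_Suc)
  qed
qed

text \<open>Markov's inequality with the target as threshold leaves at most a fraction (l - 1)
  \<open>?\<delta>\<close> of bad b for each l. Summing over at most L thresholds, with l - 1 <= L,
  gives the factor \<open>L ^ 2\<close>.\<close>

lemma card_bad_extensions_le:
  assumes C: "C \<subseteq> vecs n" and \<gamma>: "0 < \<gamma>" and good: "within_target L n p \<gamma> k C"
  shows "real (card {b \<in> vecs n. \<not> within_target L n p \<gamma> (Suc k) (C \<union> vadd b ` C)})
    \<le> 2 ^ n * (real L ^ 2 * 2 powr (- 2 * \<gamma> * n))"
proof -
  let ?T = "target n p \<gamma> k" and ?\<delta> = "2 powr (- 2 * \<gamma> * n)"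
  let ?bad = "\<lambda>l. {b \<in> vecs n. ?T l < cross n p C l b}"
  have bad: "real (card (?bad l)) \<le> 2 ^ n * (real L * ?\<delta>)" if l: "l \<in> {1..L}" for l
  proof -
    have Q: "Q_ge n p C i \<le> ?T i" if "i \<in> {1..L}" for i
      using good that by (simp add: within_target_def)
    have "real (card (?bad l)) * ?T l \<le> (\<Sum>b\<in>vecs n. cross n p C l b)"
      by (rule card_gt_le_sum) (auto simp: cross_nonneg)
    also have "\<dots> = 2 ^ n * (\<Sum>i\<in>{1..<l}. Q_ge n p C i * Q_ge n p C (l - i))"
      by (rule sum_cross[OF C])
    also have "\<dots> \<le> 2 ^ n * (\<Sum>i\<in>{1..<l}. ?T l * ?\<delta>)"
    proof (intro mult_left_mono sum_mono)
      fix i assume i: "i \<in> {1..<l}"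
      \<comment> \<open>Both i and l - i lie between 1 and L, so the invariant applies to each
        factor.\<close>
      have "Q_ge n p C i * Q_ge n p C (l - i) \<le> ?T i * ?T (l - i)"
        using i l by (intro mult_mono Q) (auto simp: Q_ge_nonneg less_imp_le[OF target_pos])
      also have "\<dots> \<le> ?T l * ?\<delta>"
        by (rule target_mult_le[OF \<gamma> i])
      finally show "Q_ge n p C i * Q_ge n p C (l - i) \<le> ?T l * ?\<delta>" .
    qed simp
    also have "\<dots> = 2 ^ n * (real (l - 1) * ?\<delta>) * ?T l"
      by simp
    finally have "real (card (?bad l)) \<le> 2 ^ n * (real (l - 1) * ?\<delta>)"
      using target_pos[of n p \<gamma> k l] by (simp only: mult_le_cancel_right_pos)
    also have "\<dots> \<le> 2 ^ n * (real L * ?\<delta>)"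
      using l by (intro mult_left_mono mult_right_mono) auto
    finally show ?thesis .
  qed
  have "{b \<in> vecs n. \<not> within_target L n p \<gamma> (Suc k) (C \<union> vadd b ` C)} \<subseteq> (\<Union>l\<in>{1..L}. ?bad l)"
    using within_target_extend[OF C _ good] by (fastforce simp: not_le[symmetric])
  then have "card {b \<in> vecs n. \<not> within_target L n p \<gamma> (Suc k) (C \<union> vadd b ` C)}
      \<le> card (\<Union>l\<in>{1..L}. ?bad l)"
    by (intro card_mono) auto
  also have "\<dots> \<le> (\<Sum>l\<in>{1..L}. card (?bad l))"
    by (rule card_UN_le) simp
  finally have "real (card {b \<in> vecs n. \<not> within_target L n p \<gamma> (Suc k) (C \<union> vadd b ` C)})
      \<le> (\<Sum>l\<in>{1..L}. real (card (?bad l)))"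
    by (simp only: of_nat_sum[symmetric] of_nat_le_iff)
  also have "\<dots> \<le> (\<Sum>l\<in>{1..L}. 2 ^ n * (real L * ?\<delta>))"
    by (intro sum_mono bad)
  also have "\<dots> = 2 ^ n * (real L ^ 2 * ?\<delta>)"
    by (simp add: power2_eq_square)
  finally show ?thesis .
qed

lemma card_bad_tuples_le:
  assumes p: "0 < p" "p < 1/2" and \<gamma>: "0 < \<gamma>"
  shows "real (card {bs \<in> tuples n k. \<not> within_target L n p \<gamma> k (lin_span n bs)})
    \<le> (2 ^ n) ^ k * (real k * (real L ^ 2 * 2 powr (- 2 * \<gamma> * n)))"
proof (induction k)
  case 0
  have "{bs \<in> tuples n 0. \<not> within_target L n p \<gamma> 0 (lin_span n bs)} = {}"
    using within_target_zero[OF p \<gamma>] by (auto simp: tuples_0)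
  then show ?case by simp
next
  case (Suc k)
  let ?\<epsilon> = "real L ^ 2 * 2 powr (- 2 * \<gamma> * n)"
  let ?good = "\<lambda>bs. within_target L n p \<gamma> k (lin_span n bs)"
  let ?good' = "\<lambda>bs. within_target L n p \<gamma> (Suc k) (lin_span n bs)"
  let ?G = "{bs \<in> tuples n k. ?good bs}" and ?B = "{bs \<in> tuples n k. \<not> ?good bs}"
  \<comment> \<open>The head of the list is the generator added last: a bad tuple either has a bad
    tail, or a good tail with a head that spoils it. The second kind costs a further fraction
    \<open>?\<epsilon>\<close>.\<close>
  have "{bs \<in> tuples n (Suc k). \<not> ?good' bs}
      \<subseteq> (\<lambda>(bs, b). b # bs) ` (?B \<times> vecs n \<union> (SIGMA bs:?G. {b \<in> vecs n. \<not> ?good' (b # bs)}))"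
    unfolding tuples_Suc by (auto simp: image_iff simp del: lin_span.simps)
  then have "card {bs \<in> tuples n (Suc k). \<not> ?good' bs}
      \<le> card (?B \<times> vecs n \<union> (SIGMA bs:?G. {b \<in> vecs n. \<not> ?good' (b # bs)}))"
    by (rule surj_card_le[rotated]) auto
  also have "\<dots> \<le> card (?B \<times> vecs n) + card (SIGMA bs:?G. {b \<in> vecs n. \<not> ?good' (b # bs)})"
    by (rule card_Un_le)
  also have "\<dots> = card ?B * 2 ^ n + (\<Sum>bs\<in>?G. card {b \<in> vecs n. \<not> ?good' (b # bs)})"
    by (simp add: card_cartesian_product card_SigmaI del: lin_span.simps)
  finally have "real (card {bs \<in> tuples n (Suc k). \<not> ?good' bs})
      \<le> real (card ?B * 2 ^ n + (\<Sum>bs\<in>?G. card {b \<in> vecs n. \<not> ?good' (b # bs)}))"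
    by (simp only: of_nat_le_iff)
  also have "\<dots> = real (card ?B) * 2 ^ n + (\<Sum>bs\<in>?G. real (card {b \<in> vecs n. \<not> ?good' (b # bs)}))"
    by simp
  also have "(\<Sum>bs\<in>?G. real (card {b \<in> vecs n. \<not> ?good' (b # bs)})) \<le> (\<Sum>bs\<in>?G. 2 ^ n * ?\<epsilon>)"
  proof (rule sum_mono)
    fix bs assume bs: "bs \<in> ?G"
    then have "lin_span n bs \<subseteq> vecs n"
      by (intro lin_span_subset_vecs) (auto simp: tuples_def)
    then show "real (card {b \<in> vecs n. \<not> ?good' (b # bs)}) \<le> 2 ^ n * ?\<epsilon>"
      unfolding lin_span.simps by (rule card_bad_extensions_le) (use bs \<gamma> in auto)
  qed
  also have "\<dots> = real (card ?G) * (2 ^ n * ?\<epsilon>)"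
    by simp
  also have "\<dots> \<le> (2 ^ n) ^ k * (2 ^ n * ?\<epsilon>)"
  proof (rule mult_right_mono)
    have "card ?G \<le> card (tuples n k)"
      by (intro card_mono) auto
    then have "real (card ?G) \<le> real ((2 ^ n) ^ k)"
      by (simp only: card_tuples of_nat_le_iff)
    then show "real (card ?G) \<le> (2 ^ n) ^ k" by simp
  qed simp
  also have "real (card ?B) * 2 ^ n \<le> (2 ^ n) ^ k * (real k * ?\<epsilon>) * 2 ^ n"
    by (intro mult_right_mono Suc.IH) simp
  finally show ?case
    by (simp add: algebra_simps)
qed

section \<open>Asymptotics of the failure probability and conclusion\<close>

lemma eventually_failure_le_exp:
  assumes "0 < \<gamma>"
  shows "\<forall>\<^sub>F n in sequentially. real n * (real L ^ 2 * 2 powr (- 2 * \<gamma> * real n)) \<le> exp (- 1 * \<gamma> * real n)"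
proof -
  \<comment> \<open>The surplus decay rate of 2^(-2 \<gamma> n) = e^(-2 \<gamma> n ln 2) over
    e^(-\<gamma> n); it absorbs the polynomial factor.\<close>
  define a where "a = \<gamma> * (2 * ln 2 - 1)"
  \<comment> \<open>This is e <= 3 < 4.\<close>
  have "1 < ln (2 ^ 2 :: real)"
    using exp_le exp_less_cancel_iff[of 1 "ln (2 ^ 2 :: real)"] by simp
  then have "1 < 2 * ln (2::real)"
    unfolding ln_realpow by simp
  then have "0 < a"
    using assms by (simp add: a_def)
  have "(\<lambda>n::nat. real n * real L ^ 2 * exp (- a * real n)) \<longlonglongrightarrow> 0"
    using \<open>0 < a\<close> by real_asymp
  then have "\<forall>\<^sub>F n::nat in sequentially. real n * real L ^ 2 * exp (- a * real n) < 1"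
    by (rule order_tendstoD) simp
  then show ?thesis
  proof eventually_elim
    case (elim n)
    have "2 powr (- 2 * \<gamma> * real n) = exp (- a * real n) * exp (- \<gamma> * real n)"
      by (simp add: powr_def a_def exp_add[symmetric] algebra_simps)
    then have "real n * (real L ^ 2 * 2 powr (- 2 * \<gamma> * real n))
        = real n * real L ^ 2 * exp (- a * real n) * exp (- \<gamma> * real n)"
      by simp
    also have "\<dots> \<le> 1 * exp (- \<gamma> * real n)"
      using elim by (intro mult_right_mono) auto
    finally show ?case by simp
  qed
qed

theorem theorem8:
  shows "\<forall>L::nat. \<exists>C>0. \<forall>p::real. 0 < p \<and> p < 1/2 \<longrightarrow>
    (\<forall>\<gamma>::real. 0 < \<gamma> \<and> \<gamma> < 1 \<longrightarrow>
      (\<exists>N. \<forall>n\<ge>N. \<forall>k::nat. real k \<le> (1 - \<gamma>) * real n \<longrightarrow>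
        real (card {bs \<in> tuples n k. \<forall>l\<in>{1..L}.
            Q_ge n p (lin_span n bs) l
              \<le> (2 powr (- real n * (1 - H p)) * 2 ^ k) ^ l * 2 powr (\<gamma> * real l ^ 2 * real n)})
          / real (card (tuples n k))
        \<ge> 1 - exp (- C * \<gamma> * real n)))"
\<comment> \<open>The constant is 1 for every L; the factor \<open>L ^ 2\<close> is absorbed by the
  choice of N.\<close>
proof (intro allI exI[where x = "1::real"] conjI impI, goal_cases)
  case 1
  then show ?case by simp
next
  case (2 L p \<gamma>)
  then have p: "0 < p" "p < 1/2" and \<gamma>: "0 < \<gamma>" by auto
  obtain N where N: "\<And>n. n \<ge> N \<Longrightarrow>
      real n * (real L ^ 2 * 2 powr (- 2 * \<gamma> * real n)) \<le> exp (- 1 * \<gamma> * real n)"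
    using eventually_failure_le_exp[OF \<gamma>] unfolding eventually_sequentially by blast
  show ?case
    unfolding target_def[symmetric] within_target_def[symmetric]
  proof (intro exI[where x = N] allI impI)
    fix n k :: nat
    assume n: "n \<ge> N" and k: "real k \<le> (1 - \<gamma>) * real n"
    let ?G = "{bs \<in> tuples n k. within_target L n p \<gamma> k (lin_span n bs)}"
    let ?B = "{bs \<in> tuples n k. \<not> within_target L n p \<gamma> k (lin_span n bs)}"
    let ?T = "(2 ^ n) ^ k :: real"
    \<comment> \<open>Bounding the number of steps by n makes N independent of k.\<close>
    have "real k \<le> real n"
      using k \<gamma> mult_right_mono[of "1 - \<gamma>" 1 "real n"] by simp
    then have "real k * (real L ^ 2 * 2 powr (- 2 * \<gamma> * real n)) \<le> exp (- 1 * \<gamma> * real n)"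
      by (intro order.trans[OF mult_right_mono N[OF n]]) auto
    then have "real (card ?B) \<le> ?T * exp (- 1 * \<gamma> * real n)"
      by (intro order.trans[OF card_bad_tuples_le[OF p \<gamma>]] mult_left_mono) auto
    moreover have "card (?G \<union> ?B) = card ?G + card ?B"
      by (rule card_Un_disjoint) auto
    then have "real (card (tuples n k)) = real (card ?G) + real (card ?B)"
      by (simp add: Un_def conj_disj_distribL[symmetric])
    then have "?T = real (card ?G) + real (card ?B)"
      by (simp add: card_tuples)
    ultimately have "?T * (1 - exp (- 1 * \<gamma> * real n)) \<le> real (card ?G)"
      by (simp add: algebra_simps)
    then show "1 - exp (- 1 * \<gamma> * real n) \<le> real (card ?G) / real (card (tuples n k))"
      by (simp add: card_tuples pos_le_divide_eq mult.commute)
  qed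
qed

end
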